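(* For every constant $L>0$ there exists an instance $(G=(V,E),K,D,\Pi)$ of the RWAP-PPP, for which $\mathrm{LP_{R2}}$ and $\mathrm{LP_{RWAP}}$ are both feasible and $z_{\mathrm{LP_{RWAP}}}>0$, such that $$\frac{z_{\mathrm{LP_{R2}}}}{z_{\mathrm{LP_{RWAP}}}}>L.$$
   Context: An instance of the RWAP-PPP (routing and wavelength assignment problem with partial path protection) consists of: a finite undirected graph $G=(V,E)$ (parallel edges allowed), each edge $e=\{u,v\}\in E$ being a link between a pair of nodes; a finite set $K$ of wavelengths; a finite set $D$ of requests, each $d\in D$ having an origin $s_d\in V$ and a destination $t_d\in V$ (different requests may share the same pair); and a set $\Pi\subseteq E$ of links that may fail. For $e=\{u,v\}\in E$ let $\alpha_1(e)=(u,v)$ and $\alpha_2(e)=(v,u)$ be the two directed arcs associated with $e$ (arcs of different edges are different), $A=\{\alpha_1(e),\alpha_2(e):e\in E\}$, and let $A^+(v)$, $A^-(v)$ be the sets of arcs of $A$ leaving and entering $v\in V$. $\mathrm{LP_{RWAP}}$ is the linear program: minimize $\sum_{\kappa\in K}\sum_{e\in E}w^{\kappa,e}$ over $x^{\kappa,a}_d\in[0,1]$ ($d\in D,\kappa\in K,a\in A$) and $w^{\kappa,e}\in[0,1]$ ($\kappa\in K,e\in E$) subject to $\sum_{\kappa\in K}\sum_{a\in A^+(s_d)}x^{\kappa,a}_d=1$ and $\sum_{\kappa\in K}\sum_{a\in A^-(s_d)}x^{\kappa,a}_d=0$ for all $d\in D$; $\sum_{a\in A^-(v)}x^{\kappa,a}_d=\sum_{a\in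 A^+(v)}x^{\kappa,a}_d$ for all $d\in D,\kappa\in K,v\in V\setminus\{s_d,t_d\}$; $\sum_{d\in D}(x^{\kappa,\alpha_1(e)}_d+x^{\kappa,\alpha_2(e)}_d)\le w^{\kappa,e}$ for all $\kappa\in K,e\in E$. $\mathrm{LP_{R2}}$ is the linear program: minimize $\sum_{\kappa\in K}\sum_{e\in E}w^{\kappa,e}$ over $y^{\kappa,a}_{\tau,d}\in[0,1]$ ($\tau\in\Pi,d\in D,\kappa\in K,a\in A$) and $w^{\kappa,e}\in[0,1]$ ($\kappa\in K,e\in E$) subject to $\sum_{a\in A^+(s_d)}\sum_{\kappa\in K}y^{\kappa,a}_{\tau,d}=1$ and $\sum_{a\in A^-(s_d)}\sum_{\kappa\in K}y^{\kappa,a}_{\tau,d}=0$ for all $\tau\in\Pi,d\in D$; $\sum_{a\in A^-(v)}y^{\kappa,a}_{\tau,d}=\sum_{a\in A^+(v)}y^{\kappa,a}_{\tau,d}$ for all $\tau\in\Pi,d\in D,\kappa\in K,v\in V\setminus\{s_d,t_d\}$; $\sum_{d\in D}(y^{\kappa,\alpha_1(e)}_{\tau,d}+y^{\kappa,\alpha_2(e)}_{\tau,d})\le w^{\kappa,e}$ for all $\tau\in\Pi,\kappa\in K,e\in E$; $y^{\kappa,\alpha_1(\tau)}_{\tau,d}+y^{\kappa,\alpha_2(\tau)}_{\tau,d}=0$ for all $\tau\in\Pi,d\in D,\kappa\in K$. $z_M$ denotes the optimal objective value of model $M$. *)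

theory Defs
  imports Complex_Main "Graph_Theory.Digraph"
begin

text \<open>
  The multigraph is given by a set of link names together with their end nodes, so that parallel
  links are distinct. The order of the pair \<open>ends I e\<close> carries no meaning for the undirected link;
  it only fixes which of the two arcs of \<open>e\<close> is called \<open>\<alpha>\<^sub>1(e)\<close>.
\<close>

record ('v, 'e, 'k, 'd) rwap_ppp =
  nodes :: "'v set"
  links :: "'e set"
  ends :: "'e \<Rightarrow> 'v \<times> 'v"
  wavelengths :: "'k set"
  requests :: "'d set"
  origin :: "'d \<Rightarrow> 'v"
  destination :: "'d \<Rightarrow> 'v"
  failing :: "'e set"

text \<open>
  Distinctness of \<open>origin I d\<close> and \<open>destination I d\<close> is not demanded: a request violating it makes
  \<open>LP\<^sub>R\<^sub>W\<^sub>A\<^sub>P\<close> infeasible.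
\<close>

definition rwap_ppp_instance :: "('v, 'e, 'k, 'd) rwap_ppp \<Rightarrow> bool" where
  "rwap_ppp_instance I \<longleftrightarrow>
     finite (nodes I) \<and> finite (links I) \<and> finite (wavelengths I) \<and> finite (requests I) \<and>
     (\<forall>e \<in> links I. fst (ends I e) \<in> nodes I \<and> snd (ends I e) \<in> nodes I \<and>
        fst (ends I e) \<noteq> snd (ends I e)) \<and>
     (\<forall>d \<in> requests I. origin I d \<in> nodes I \<and> destination I d \<in> nodes I) \<and>
     failing I \<subseteq> links I"

datatype 'e arc = Alpha1 'e | Alpha2 'e

fun arc_tail :: "('e \<Rightarrow> 'v \<times> 'v) \<Rightarrow> 'e arc \<Rightarrow> 'v" where
  "arc_tail f (Alpha1 e) = fst (f e)"
| "arc_tail f (Alpha2 e) = snd (f e)"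

fun arc_head :: "('e \<Rightarrow> 'v \<times> 'v) \<Rightarrow> 'e arc \<Rightarrow> 'v" where
  "arc_head f (Alpha1 e) = snd (f e)"
| "arc_head f (Alpha2 e) = fst (f e)"

definition bidirected :: "('v, 'e, 'k, 'd) rwap_ppp \<Rightarrow> ('v, 'e arc) pre_digraph" where
  "bidirected I =
     \<lparr>verts = nodes I, arcs = Alpha1 ` links I \<union> Alpha2 ` links I,
      tail = arc_tail (ends I), head = arc_head (ends I)\<rparr>"

abbreviation arcs_out :: "('v, 'e, 'k, 'd) rwap_ppp \<Rightarrow> 'v \<Rightarrow> 'e arc set" where
  "arcs_out I v \<equiv> out_arcs (bidirected I) v"

abbreviation arcs_in :: "('v, 'e, 'k, 'd) rwap_ppp \<Rightarrow> 'v \<Rightarrow> 'e arc set" where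
  "arcs_in I v \<equiv> in_arcs (bidirected I) v"

definition cost :: "('v, 'e, 'k, 'd) rwap_ppp \<Rightarrow> ('k \<Rightarrow> 'e \<Rightarrow> real) \<Rightarrow> real" where
  "cost I w = (\<Sum>\<kappa> \<in> wavelengths I. \<Sum>e \<in> links I. w \<kappa> e)"

text \<open>
  Below, \<open>x d \<kappa> a\<close>, \<open>y \<tau> d \<kappa> a\<close> and \<open>w \<kappa> e\<close> are the LP variables; their values at indices outside
  the instance are unconstrained and do not affect the objective.
\<close>

definition LP_RWAP ::
  "('v, 'e, 'k, 'd) rwap_ppp \<Rightarrow> (('d \<Rightarrow> 'k \<Rightarrow> 'e arc \<Rightarrow> real) \<times> ('k \<Rightarrow> 'e \<Rightarrow> real)) set" where
  "LP_RWAP I = {(x, w).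
     (\<forall>d \<in> requests I. \<forall>\<kappa> \<in> wavelengths I. \<forall>a \<in> arcs (bidirected I). x d \<kappa> a \<in> {0..1}) \<and>
     (\<forall>\<kappa> \<in> wavelengths I. \<forall>e \<in> links I. w \<kappa> e \<in> {0..1}) \<and>
     (\<forall>d \<in> requests I.
        (\<Sum>\<kappa> \<in> wavelengths I. \<Sum>a \<in> arcs_out I (origin I d). x d \<kappa> a) = 1 \<and>
        (\<Sum>\<kappa> \<in> wavelengths I. \<Sum>a \<in> arcs_in I (origin I d). x d \<kappa> a) = 0) \<and>
     (\<forall>d \<in> requests I. \<forall>\<kappa> \<in> wavelengths I. \<forall>v \<in> nodes I - {origin I d, destination I d}.
        (\<Sum>a \<in> arcs_in I v. x d \<kappa> a) = (\<Sum>a \<in> arcs_out I v. x d \<kappa> a)) \<and>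
     (\<forall>\<kappa> \<in> wavelengths I. \<forall>e \<in> links I.
        (\<Sum>d \<in> requests I. x d \<kappa> (Alpha1 e) + x d \<kappa> (Alpha2 e)) \<le> w \<kappa> e)}"

definition LP_R2 ::
  "('v, 'e, 'k, 'd) rwap_ppp \<Rightarrow> (('e \<Rightarrow> 'd \<Rightarrow> 'k \<Rightarrow> 'e arc \<Rightarrow> real) \<times> ('k \<Rightarrow> 'e \<Rightarrow> real)) set" where
  "LP_R2 I = {(y, w).
     (\<forall>\<tau> \<in> failing I. \<forall>d \<in> requests I. \<forall>\<kappa> \<in> wavelengths I. \<forall>a \<in> arcs (bidirected I).
        y \<tau> d \<kappa> a \<in> {0..1}) \<and>
     (\<forall>\<kappa> \<in> wavelengths I. \<forall>e \<in> links I. w \<kappa> e \<in> {0..1}) \<and>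
     (\<forall>\<tau> \<in> failing I. \<forall>d \<in> requests I.
        (\<Sum>a \<in> arcs_out I (origin I d). \<Sum>\<kappa> \<in> wavelengths I. y \<tau> d \<kappa> a) = 1 \<and>
        (\<Sum>a \<in> arcs_in I (origin I d). \<Sum>\<kappa> \<in> wavelengths I. y \<tau> d \<kappa> a) = 0) \<and>
     (\<forall>\<tau> \<in> failing I. \<forall>d \<in> requests I. \<forall>\<kappa> \<in> wavelengths I.
        \<forall>v \<in> nodes I - {origin I d, destination I d}.
        (\<Sum>a \<in> arcs_in I v. y \<tau> d \<kappa> a) = (\<Sum>a \<in> arcs_out I v. y \<tau> d \<kappa> a)) \<and>
     (\<forall>\<tau> \<in> failing I. \<forall>\<kappa> \<in> wavelengths I. \<forall>e \<in> links I.
        (\<Sum>d \<in> requests I. y \<tau> d \<kappa> (Alpha1 e) + y \<tau> d \<kappa> (Alpha2 e)) \<le> w \<kappa> e) \<and>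
     (\<forall>\<tau> \<in> failing I. \<forall>d \<in> requests I. \<forall>\<kappa> \<in> wavelengths I.
        y \<tau> d \<kappa> (Alpha1 \<tau>) + y \<tau> d \<kappa> (Alpha2 \<tau>) = 0)}"

text \<open>
  Optimal values are infima over the feasible set. The objective is bounded below by 0, so for a
  feasible program this is a genuine infimum (attained, as for every bounded feasible LP); it is
  meaningful only together with feasibility.
\<close>

definition z_RWAP :: "('v, 'e, 'k, 'd) rwap_ppp \<Rightarrow> real" where
  "z_RWAP I = (INF (x, w) \<in> LP_RWAP I. cost I w)"

definition z_R2 :: "('v, 'e, 'k, 'd) rwap_ppp \<Rightarrow> real" where
  "z_R2 I = (INF (y, w) \<in> LP_R2 I. cost I w)"

end

theory Submission
  imports Defs
begin

text \<open>
  On a cycle, a single request between two adjacent nodes is routed along the joining link at cost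
  1. If this link fails, flow conservation pushes the whole unit around the \<open>n\<close> other links, so
  that \<open>LP\<^sub>R\<^sub>2\<close> costs at least \<open>n\<close>.
\<close>

definition cycle_instance :: "nat \<Rightarrow> (nat, nat, nat, nat) rwap_ppp" where
  "cycle_instance n =
     \<lparr>nodes = {..n}, links = {..n}, ends = (\<lambda>e. if e < n then (e, Suc e) else (0, n)),
      wavelengths = {0}, requests = {0}, origin = (\<lambda>_. 0), destination = (\<lambda>_. n),
      failing = {n}\<rparr>"

lemma cycle_instance_simps [simp]:
  "nodes (cycle_instance n) = {..n}"
  "links (cycle_instance n) = {..n}"
  "ends (cycle_instance n) = (\<lambda>e. if e < n then (e, Suc e) else (0, n))"
  "wavelengths (cycle_instance n) = {0}"
  "requests (cycle_instance n) = {0}"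
  "origin (cycle_instance n) = (\<lambda>_. 0)"
  "destination (cycle_instance n) = (\<lambda>_. n)"
  "failing (cycle_instance n) = {n}"
  by (simp_all add: cycle_instance_def)

lemma rwap_ppp_instance_cycle_instance: "0 < n \<Longrightarrow> rwap_ppp_instance (cycle_instance n)"
  by (auto simp: rwap_ppp_instance_def)

text \<open>Every \<open>Alpha1\<close> arc points away from node 0, both along the path 0, 1, ...,
  n and on the closing link \<open>n\<close>. For \<open>n = 1\<close> the two links are
  parallel.\<close>

lemma arcs_out_cycle_origin: "0 < n \<Longrightarrow> arcs_out (cycle_instance n) 0 = {Alpha1 0, Alpha1 n}"
  by (auto simp: out_arcs_def bidirected_def split: if_splits)

lemma arcs_in_cycle_origin: "0 < n \<Longrightarrow> arcs_in (cycle_instance n) 0 = {Alpha2 0, Alpha2 n}"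
  by (auto simp: in_arcs_def bidirected_def split: if_splits)

lemma arcs_out_cycle_Suc:
  "Suc v < n \<Longrightarrow> arcs_out (cycle_instance n) (Suc v) = {Alpha1 (Suc v), Alpha2 v}"
  by (auto simp: out_arcs_def bidirected_def split: if_splits)

lemma arcs_in_cycle_Suc:
  "Suc v < n \<Longrightarrow> arcs_in (cycle_instance n) (Suc v) = {Alpha1 v, Alpha2 (Suc v)}"
  by (auto simp: in_arcs_def bidirected_def split: if_splits)

lemma arcs_bidirected_cycle:
  "arcs (bidirected (cycle_instance n)) = Alpha1 ` {..n} \<union> Alpha2 ` {..n}"
  by (simp add: bidirected_def)

lemmas arcs_cycle = arcs_out_cycle_origin arcs_in_cycle_origin
  arcs_out_cycle_Suc arcs_in_cycle_Suc arcs_bidirected_cycle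

lemma cost_cycle: "cost (cycle_instance n) w = (\<Sum>e<n. w 0 e) + w 0 n"
  by (simp add: cost_def lessThan_Suc_atMost [symmetric])

text \<open>Brings the nodes subject to flow conservation into the form \<open>Suc u\<close>, on
  which the arc lemmas rewrite.\<close>

lemma inner_node_cycle:
  assumes "v \<in> {..n} - {0, n}"
  obtains u where "v = Suc u" "Suc u < n"
  using assms by (cases v) auto

lemma direct_routing_mem_LP_RWAP:
  fixes n :: nat
  assumes "0 < n"
  shows "(\<lambda>_ _ a. if a = Alpha1 n then 1 else 0, \<lambda>_ e. if e = n then 1 else 0)
           \<in> LP_RWAP (cycle_instance n)"
  using assms unfolding LP_RWAP_def
  by (auto simp: arcs_cycle elim!: inner_node_cycle)

text \<open>Serves to make the feasible set nonempty, so \<open>w\<close> can be constantly 1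
  without regard to cost.\<close>

lemma detour_routing_mem_LP_R2:
  assumes "0 < n"
  shows "(\<lambda>_ _ _ a. if a \<in> Alpha1 ` {..<n} then 1 else 0, \<lambda>_ _. 1) \<in> LP_R2 (cycle_instance n)"
  using assms unfolding LP_R2_def
  by (auto simp: arcs_cycle image_iff elim!: inner_node_cycle)

text \<open>The unit leaving the origin is split between links 0 and \<open>n\<close>, and the
  capacities of these two links already pay for it.\<close>

lemma one_le_cost_LP_RWAP_cycle:
  assumes "0 < n" "(x, w) \<in> LP_RWAP (cycle_instance n)"
  shows "1 \<le> cost (cycle_instance n) w"
proof -
  note feas = assms(2)[unfolded LP_RWAP_def, simplified]
  have out: "x 0 0 (Alpha1 0) + x 0 0 (Alpha1 n) = 1"
    using feas assms(1) by (simp add: arcs_cycle)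
  have nonneg: "0 \<le> x 0 0 (Alpha2 e)" if "e \<le> n" for e
    using feas that by (auto simp: arcs_cycle)
  have cap: "x 0 0 (Alpha1 e) + x 0 0 (Alpha2 e) \<le> w 0 e" if "e \<le> n" for e
    using feas that by auto
  have "w 0 0 \<le> (\<Sum>e<n. w 0 e)"
    using feas assms(1) by (intro member_le_sum) auto
  with out nonneg[of 0] nonneg[of n] cap[of 0] cap[of n] show ?thesis
    by (simp add: cost_cycle)
qed

lemma le_cost_LP_R2_cycle:
  assumes "0 < n" "(y, w) \<in> LP_R2 (cycle_instance n)"
  shows "real n \<le> cost (cycle_instance n) w"
proof -
  note feas = assms(2)[unfolded LP_R2_def, simplified]
  define f where "f = y n 0 0"
  have nonneg: "0 \<le> f (Alpha1 e)" "0 \<le> f (Alpha2 e)" if "e \<le> n" for e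
    using feas that by (auto simp: arcs_cycle f_def)
  have out: "f (Alpha1 0) + f (Alpha1 n) = 1" and "in": "f (Alpha2 0) + f (Alpha2 n) = 0"
    and fail: "f (Alpha1 n) + f (Alpha2 n) = 0"
    using feas assms(1) by (simp_all add: arcs_cycle f_def)
  have cap: "f (Alpha1 e) + f (Alpha2 e) \<le> w 0 e" if "e \<le> n" for e
    using feas that by (auto simp: f_def)
  \<comment> \<open>The invariant is the net flow, because inner links may carry flow in both
    directions; conservation at \<open>Suc e\<close> says exactly that links \<open>e\<close> and
    \<open>Suc e\<close> have equal net flow. At the origin, nonnegativity kills both entering arcs
    and the failure kills \<open>Alpha1 n\<close>, so the unit leaves on
    \<open>Alpha1 0\<close>.\<close>
  have net: "f (Alpha1 e) - f (Alpha2 e) = 1" if "e < n" for e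
    using that
  proof (induction e)
    case 0
    then show ?case using out "in" fail nonneg[of 0] nonneg[of n] by simp
  next
    case (Suc e)
    have "\<forall>v\<in>{..n} - {0, n}. sum f (arcs_in (cycle_instance n) v) = sum f (arcs_out (cycle_instance n) v)"
      using feas by (simp add: f_def)
    with Suc.prems have "sum f (arcs_in (cycle_instance n) (Suc e)) = sum f (arcs_out (cycle_instance n) (Suc e))"
      by simp
    with Suc show ?case by (simp add: arcs_cycle)
  qed
  \<comment> \<open>Reverse flow is nonnegative, so the total flow on a link is at least its net
    flow.\<close>
  have "1 \<le> w 0 e" if "e < n" for e
    using net[OF that] cap[of e] nonneg[of e] that by linarith
  then have "(\<Sum>e<n. 1) \<le> (\<Sum>e<n. w 0 e)"
    by (intro sum_mono) simp
  moreover have "0 \<le> w 0 n"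
    using feas by auto
  ultimately show ?thesis
    by (simp add: cost_cycle)
qed

lemma z_RWAP_cycle:
  assumes "0 < n"
  shows "z_RWAP (cycle_instance n) = 1"
proof (rule antisym)
  let ?x = "\<lambda>_ _ a. if a = Alpha1 n then 1 else 0" and ?w = "\<lambda>_ e. if e = n then 1 else 0"
  \<comment> \<open>The reals are only conditionally complete, so bounding the infimum by a member's
    cost needs a lower bound.\<close>
  have "bdd_below ((\<lambda>(x, w). cost (cycle_instance n) w) ` LP_RWAP (cycle_instance n))"
    using one_le_cost_LP_RWAP_cycle[OF assms] by (intro bdd_belowI2[of _ 1]) auto
  from cINF_lower[OF this direct_routing_mem_LP_RWAP[OF assms]]
  show "z_RWAP (cycle_instance n) \<le> 1"
    by (simp add: z_RWAP_def cost_cycle)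
next
  show "1 \<le> z_RWAP (cycle_instance n)"
    unfolding z_RWAP_def using direct_routing_mem_LP_RWAP[OF assms] one_le_cost_LP_RWAP_cycle[OF assms]
    by (intro cINF_greatest) auto
qed

lemma le_z_R2_cycle:
  assumes "0 < n"
  shows "real n \<le> z_R2 (cycle_instance n)"
  unfolding z_R2_def using detour_routing_mem_LP_R2[OF assms] le_cost_LP_R2_cycle[OF assms]
  by (intro cINF_greatest) auto

theorem proposition2:
  fixes L :: real
  assumes "L > 0"
  shows "\<exists>I :: (nat, nat, nat, nat) rwap_ppp.
    rwap_ppp_instance I \<and> LP_R2 I \<noteq> {} \<and> LP_RWAP I \<noteq> {} \<and> z_RWAP I > 0 \<and>
    z_R2 I / z_RWAP I > L"
proof -
  \<comment> \<open>The ratio is at least \<open>n / 1\<close>, so any \<open>n\<close> above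
    \<open>L\<close> works; \<open>L > 0\<close> makes \<open>n\<close> positive.\<close>
  obtain n where n: "L < real n"
    using reals_Archimedean2 by blast
  with assms have "0 < n"
    using of_nat_0_less_iff order_less_trans by blast
  then show ?thesis
    using n rwap_ppp_instance_cycle_instance[of n] direct_routing_mem_LP_RWAP[of n]
      detour_routing_mem_LP_R2[of n] z_RWAP_cycle[of n] le_z_R2_cycle[of n]
    by (intro exI[of _ "cycle_instance n"]) auto
qed

end
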